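(* Let $p$ be an odd prime. For each $a\in\mathbb{F}_p^\times$, set $f_a(X)=X^p-X+a\in\mathbb{F}_p[X]$, and let $e$ denote the order of $f_{-1}(X)=X^p-X-1$. Let $\ell$ be an odd prime divisor of $e$. \begin{enumerate} \item If $\ell\nmid \frac{p^p-1}{e}$, then for every integer $m\geq 0$ each of the polynomials $f_1(X^{\ell^m}),f_2(X^{\ell^m}),\dots,f_{p-1}(X^{\ell^m})$ is irreducible over $\mathbb{F}_p$. Consequently $$\{(f_1(X^{\ell^m}),f_2(X^{\ell^m}),\dots,f_{p-1}(X^{\ell^m})): m\geq 0\}$$ is an infinite family of twin prime tuples of odd degree $p\ell^m$ over $\mathbb{F}_p$. \item If $\ell\mid \frac{p^p-1}{e}$, then $\ell$ is a Wieferich prime in base $p$, i.e. $p^{\ell-1}\equiv 1 \pmod{\ell^2}$. \end{enumerate}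
   Context: A prime polynomial over $\mathbb{F}_q$ is a monic irreducible polynomial. The size of a nonzero $g\in\mathbb{F}_q[X]$ of degree $n$ is $|g|_q=q^n$. Prime polynomials $g,h$ form a twin prime pair if $|g-h|_q=1$, i.e. $g-h$ is a nonzero constant; a twin prime tuple is a tuple of prime polynomials any two of which differ by a nonzero constant. The polynomial $X^p-X-1$ is irreducible over $\mathbb{F}_p$; its order $e$ is defined as the multiplicative order of any of its roots in $\mathbb{F}_{p^p}^\times$ (all roots are Galois conjugate and have the same order). A prime $\ell$ with $(b,\ell)=1$ is a Wieferich prime in base $b$ if $b^{\ell-1}\equiv 1 \pmod{\ell^2}$. *)

theory Defs
  imports
    "HOL-Algebra.Algebraic_Closure_Type"
    "HOL-Algebra.Multiplicative_Group"
    "HOL-Number_Theory.Cong"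
    "Berlekamp_Zassenhaus.Finite_Field"
begin

text \<open>
  The field with \<open>p\<close> elements is \<^typ>\<open>'p mod_ring\<close> with \<open>'p :: prime_card\<close> and \<open>p = CARD('p)\<close>.
\<close>

definition prime_poly :: "'a :: {field, finite} poly \<Rightarrow> bool" where
  "prime_poly g \<longleftrightarrow> Polynomial.lead_coeff g = 1 \<and> Factorial_Ring.irreducible g"

definition poly_size :: "'a :: {field, finite} poly \<Rightarrow> nat" where
  "poly_size g = (if g = 0 then 0 else CARD('a) ^ Polynomial.degree g)"

definition twin_prime_pair :: "'a :: {field, finite} poly \<Rightarrow> 'a poly \<Rightarrow> bool" where
  "twin_prime_pair g h \<longleftrightarrow> prime_poly g \<and> prime_poly h \<and> poly_size (g - h) = 1"

definition twin_prime_tuple :: "'a :: {field, finite} poly list \<Rightarrow> bool" where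
  "twin_prime_tuple gs \<longleftrightarrow>
     (\<forall>g \<in> set gs. prime_poly g) \<and>
     (\<forall>i < length gs. \<forall>j < length gs. i \<noteq> j \<longrightarrow> twin_prime_pair (gs ! i) (gs ! j))"

definition artin_schreier :: "'p :: prime_card mod_ring \<Rightarrow> 'p mod_ring poly" where
  "artin_schreier a = Polynomial.monom 1 CARD('p) - Polynomial.monom 1 1 + [:a:]"

text \<open>
  The field with \<open>p\<^sup>p\<close> elements is realised inside the algebraic closure of the prime field, as the
  set of solutions of \<open>x ^ (p ^ p) = x\<close>; the following is its multiplicative group.
\<close>

definition Fpp_units :: "'p :: prime_card mod_ring alg_closure monoid" where
  "Fpp_units =
     \<lparr>carrier = {x. x ^ (CARD('p) ^ CARD('p)) = x} - {0}, monoid.mult = (*), one = 1\<rparr>"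

lemma group_Fpp_units: "group (Fpp_units :: 'p :: prime_card mod_ring alg_closure monoid)"
proof (rule groupI)
  fix x :: "'p mod_ring alg_closure"
  assume x: "x \<in> carrier Fpp_units"
  have "inverse x \<in> carrier Fpp_units" "inverse x \<otimes>\<^bsub>Fpp_units\<^esub> x = \<one>\<^bsub>Fpp_units\<^esub>"
    using x by (auto simp: Fpp_units_def power_inverse)
  thus "\<exists>y \<in> carrier Fpp_units. y \<otimes>\<^bsub>Fpp_units\<^esub> x = \<one>\<^bsub>Fpp_units\<^esub>"
    by blast
qed (auto simp: Fpp_units_def power_mult_distrib)

lemma root_in_Fpp_units:
  fixes \<alpha> :: "'p :: prime_card mod_ring alg_closure"
  assumes "poly (map_poly to_ac (artin_schreier (-1))) \<alpha> = 0"
  shows "\<alpha> \<in> carrier Fpp_units"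
proof -
  have p: "prime CHAR('p mod_ring alg_closure)" "CHAR('p mod_ring alg_closure) = CARD('p)"
    using prime_card[where 'a = 'p] by simp_all
  have "map_poly to_ac (artin_schreier (-1) :: 'p mod_ring poly) =
          Polynomial.monom 1 CARD('p) - Polynomial.monom 1 1 + [:-1:]" (is "_ = ?f")
    by (rule poly_eqI)
       (auto simp: artin_schreier_def coeff_map_poly coeff_pCons split: nat.splits)
  with assms have "poly ?f \<alpha> = 0"
    by (simp only:)
  hence step: "\<alpha> ^ CARD('p) = \<alpha> + 1"
    by (simp add: poly_monom algebra_simps)
  have frob: "(x + y) ^ CARD('p) = x ^ CARD('p) + y ^ CARD('p)" for x y :: "'p mod_ring alg_closure"
    using freshmans_dream[where x = x and y = y] p by metis
  have nat: "(of_nat n :: 'p mod_ring alg_closure) ^ CARD('p) = of_nat n" for n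
    using prime_gt_0_nat[OF prime_card[where 'a = 'p]]
    by (induction n) (auto simp: frob)
  have "\<alpha> ^ (CARD('p) ^ n) = \<alpha> + of_nat n" for n
  proof (induction n)
    case (Suc n)
    have "\<alpha> ^ (CARD('p) ^ Suc n) = (\<alpha> ^ (CARD('p) ^ n)) ^ CARD('p)"
      by (simp add: power_mult [symmetric] mult.commute)
    thus ?case
      using Suc by (simp add: frob nat step)
  qed auto
  moreover have "of_nat CARD('p) = (0 :: 'p mod_ring alg_closure)"
    using p(2) by (metis of_nat_CHAR)
  moreover have "\<alpha> \<noteq> 0"
    using step prime_gt_0_nat[OF prime_card[where 'a = 'p]] by (auto simp: zero_power)
  ultimately show ?thesis
    by (simp add: Fpp_units_def)
qed

definition wieferich_prime :: "nat \<Rightarrow> nat \<Rightarrow> bool" where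
  "wieferich_prime b l \<longleftrightarrow>
     Factorial_Ring.prime l \<and> coprime b l \<and> [b ^ (l - 1) = 1] (mod (l ^ 2))"

end

theory Submission
  imports Defs "HOL-Number_Theory.Number_Theory"
    "Berlekamp_Zassenhaus.Distinct_Degree_Factorization"
begin

text \<open>
  The conjugates of a root \<open>\<alpha>\<close> of \<open>X\<^sup>p - X - 1\<close> are the \<open>\<alpha> + i\<close>, so \<open>\<alpha>\<close> has norm \<open>1\<close> and \<open>e\<close> divides
  \<open>1 + p + \<dots> + p\<^bsup>p-1\<^esup>\<close>. Hence \<open>l\<close> does not divide \<open>p - 1\<close>, and \<open>p\<close> has order exactly \<open>p\<close> modulo \<open>l\<close>.

  If \<open>l\<close> does not divide \<open>(p\<^sup>p - 1) / e\<close>, let \<open>l\<^sup>s\<close> be the exact power of \<open>l\<close> in \<open>e\<close>, and so in \<open>p\<^sup>p - 1\<close>.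
  A root \<open>\<theta>\<close> of an irreducible factor of \<open>f\<^sub>a(X\<^bsup>l^m\<^esup>)\<close> of degree \<open>d\<close> satisfies \<open>\<theta>\<^bsup>p^d - 1\<^esup> = 1\<close>, and
  \<open>\<theta>\<^bsup>l^m\<^esup>\<close> is \<open>-a\<close> times a conjugate of \<open>\<alpha>\<close>, so \<open>l\<^bsup>s+m\<^esup>\<close> divides \<open>p\<^sup>d - 1\<close>. Thus \<open>p\<close> divides \<open>d\<close>, and by
  lifting the exponent \<open>p l\<^sup>m\<close> divides \<open>d\<close>: the factor is the whole polynomial.

  If \<open>l\<close> divides \<open>(p\<^sup>p - 1) / e\<close>, then \<open>l\<^sup>2\<close> divides \<open>p\<^sup>p - 1\<close>, which divides \<open>p\<^bsup>l-1\<^esup> - 1\<close> since \<open>p\<close> divides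
  \<open>l - 1\<close>.
\<close>

section \<open>Powers of an odd prime dividing \<open>x ^ k - 1\<close>\<close>

lemma cong_one_imp_sum_powers_cong:
  fixes x l :: int
  assumes "[x = 1] (mod l)"
  shows "[(\<Sum>i<n. x ^ i) = int n] (mod l)"
proof -
  have "[(\<Sum>i<n. x ^ i) = (\<Sum>i<n. 1)] (mod l)"
    using assms by (intro cong_sum) (metis cong_pow power_one)
  thus ?thesis by simp
qed

text \<open>The cofactor of \<open>x - 1\<close> in \<open>x ^ k - 1\<close> is congruent to
  \<open>k\<close> modulo \<open>l\<close>, hence prime to \<open>l\<close>.\<close>

lemma power_sub_one_dvd_iff:
  fixes x :: int and l :: nat
  assumes "prime l" "[x = 1] (mod int l)" "\<not> l dvd k"
  shows "int l ^ s dvd x ^ k - 1 \<longleftrightarrow> int l ^ s dvd x - 1"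
proof -
  have "\<not> int l dvd (\<Sum>i<k. x ^ i)"
    using cong_one_imp_sum_powers_cong[OF assms(2), of k] assms(3)
    by (simp add: cong_dvd_iff)
  \<comment> \<open>\<open>Berlekamp_Zassenhaus\<close> shadows the standard \<open>coprime\<close> by a constant of its own.\<close>
  hence "Rings.coprime (int l ^ s) (\<Sum>i<k. x ^ i)"
    using assms(1) by (simp add: prime_imp_coprime)
  thus ?thesis
    by (simp add: power_diff_1_eq coprime_dvd_mult_left_iff)
qed

text \<open>For exponent \<open>l\<close> the cofactor of \<open>x - 1\<close> is \<open>l\<close>
  times a number congruent to 1 modulo \<open>l\<close>, so exactly one factor \<open>l\<close> is
  gained.\<close>

lemma power_prime_sub_one_dvd_iff:
  fixes x :: int and l :: nat
  assumes "prime l" "odd l" "[x = 1] (mod int l)"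
  shows "int l ^ Suc s dvd x ^ l - 1 \<longleftrightarrow> int l ^ s dvd x - 1"
proof -
  obtain y where y: "x = 1 + int l * y"
    using assms(3) by (metis add.commute cong_iff_dvd_diff diff_add_cancel dvdE)
  \<comment> \<open>Binomial expansion to first order: the higher terms contain the square of
    \<open>l\<close>.\<close>
  have pow: "[x ^ i = 1 + int i * int l * y] (mod (int l)\<^sup>2)" for i
  proof (induction i)
    case (Suc i)
    have "[x ^ Suc i = (1 + int l * y) * (1 + int i * int l * y)] (mod (int l)\<^sup>2)"
      using cong_scalar_left[OF Suc, of x] y by simp
    also have "(1 + int l * y) * (1 + int i * int l * y) =
                 1 + int (Suc i) * int l * y + (int l)\<^sup>2 * (int i * y\<^sup>2)"
      by (simp add: algebra_simps power2_eq_square)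
    also have "[\<dots> = 1 + int (Suc i) * int l * y] (mod (int l)\<^sup>2)"
      by (simp add: cong_iff_dvd_diff)
    finally show ?case .
  qed auto
  obtain q where q: "l = 2 * q + 1"
    using assms(2) by (elim oddE)
  \<comment> \<open>Oddness of \<open>l\<close> enters here: \<open>l * (l - 1) / 2\<close> is then
    a multiple of \<open>l\<close>.\<close>
  have gauss: "(\<Sum>i<l. int i) = int l * int q"
    unfolding q by (induction q) (auto simp: algebra_simps)
  have "[(\<Sum>i<l. x ^ i) = (\<Sum>i<l. 1 + int i * int l * y)] (mod (int l)\<^sup>2)"
    by (intro cong_sum pow)
  also have "(\<Sum>i<l. 1 + int i * int l * y) = int l + (\<Sum>i<l. int i) * (int l * y)"
    by (simp add: sum.distrib sum_distrib_right mult.assoc)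
  also have "\<dots> = int l + (int l)\<^sup>2 * (int q * y)"
    unfolding gauss by (simp add: power2_eq_square)
  finally have "(int l)\<^sup>2 dvd (\<Sum>i<l. x ^ i) - (int l + (int l)\<^sup>2 * (int q * y))"
    by (simp add: cong_iff_dvd_diff)
  then obtain t where "(\<Sum>i<l. x ^ i) - (int l + (int l)\<^sup>2 * (int q * y)) = (int l)\<^sup>2 * t"
    by (elim dvdE)
  hence S: "(\<Sum>i<l. x ^ i) = int l * (1 + int l * (t + int q * y))"
    by (simp add: algebra_simps power2_eq_square)
  define u where "u = 1 + int l * (t + int q * y)"
  have "Rings.coprime (int l ^ s) u"
  proof -
    have "Rings.coprime (int l) u"
      unfolding u_def by (rule algebraic_semidom_class.coprimeI) (metis dvd_add_left_iff dvd_mult2)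
    thus ?thesis by simp
  qed
  hence "int l ^ s dvd (x - 1) * u \<longleftrightarrow> int l ^ s dvd x - 1"
    by (simp add: coprime_dvd_mult_left_iff)
  moreover have "x ^ l - 1 = int l * ((x - 1) * u)"
    by (simp add: power_diff_1_eq S u_def)
  ultimately show ?thesis
    using prime_gt_0_nat[OF assms(1)] by simp
qed

text \<open>Each induction step strips one factor \<open>l\<close> from \<open>k\<close> and passes
  from \<open>x\<close> to \<open>x ^ l\<close>, which raises the bound \<open>s\<close> by exactly
  one.\<close>

lemma prime_power_dvd_exponent:
  fixes x :: int and l :: nat
  assumes l: "prime l" "odd l"
  shows "[x = 1] (mod int l) \<Longrightarrow> \<not> int l ^ Suc s dvd x - 1 \<Longrightarrow>
           int l ^ (s + m) dvd x ^ k - 1 \<Longrightarrow> l ^ m dvd k"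
proof (induction m arbitrary: x s k)
  case (Suc m)
  have "int l ^ Suc s dvd x ^ k - 1"
    using Suc.prems(3) by (rule power_le_dvd) simp
  hence "l dvd k"
    using power_sub_one_dvd_iff[OF l(1) Suc.prems(1)] Suc.prems(2) by blast
  then obtain k' where k: "k = l * k'" by (elim dvdE)
  have "[x ^ l = 1] (mod int l)"
    using cong_pow[OF Suc.prems(1), of l] by simp
  moreover have "\<not> int l ^ Suc (Suc s) dvd x ^ l - 1"
    using power_prime_sub_one_dvd_iff[OF l Suc.prems(1)] Suc.prems(2) by blast
  moreover have "int l ^ (Suc s + m) dvd (x ^ l) ^ k' - 1"
    using Suc.prems(3) by (simp add: k power_mult)
  ultimately show ?case
    using Suc.IH[of "x ^ l" "Suc s" k'] by (simp add: k)
qed simp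

text \<open>The order of \<open>p\<close> modulo \<open>l\<close> divides the prime \<open>p\<close>
  and is not 1, so it equals \<open>p\<close>.\<close>

lemma prime_power_order_cong_iff:
  fixes p l n :: nat
  assumes "prime p" "[p ^ p = 1] (mod l)" "\<not> [p = 1] (mod l)"
  shows "[p ^ n = 1] (mod l) \<longleftrightarrow> p dvd n"
proof -
  have "Pocklington.ord l p dvd p"
    using assms(2) by (simp only: ord_divides)
  moreover have "Pocklington.ord l p \<noteq> 1"
    using assms(3) ord_divides[of p 1 l] by auto
  ultimately have "Pocklington.ord l p = p"
    using assms(1) by (auto simp: prime_nat_iff)
  thus ?thesis by (simp only: ord_divides)
qed

section \<open>Roots of \<open>X^p - X - 1\<close>: conjugates, norm and orders\<close>

lemma of_nat_power_CHAR:
  assumes "prime CHAR('a :: comm_semiring_1)"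
  shows "(of_nat n :: 'a) ^ CHAR('a) = of_nat n"
  using prime_gt_0_nat[OF assms]
  by (induction n) (auto simp: freshmans_dream[OF assms refl] zero_power)

text \<open>As polynomials in \<open>x\<close>, both sides are monic of degree
  \<open>CHAR('a)\<close> and vanish on the whole prime field, which has that many elements.\<close>

lemma prod_add_of_nat_CHAR:
  fixes x :: "'a :: idom"
  assumes p: "prime CHAR('a)"
  shows "(\<Prod>i<CHAR('a). x + of_nat i) = x ^ CHAR('a) - x"
proof -
  define P where "P = (\<Prod>i<CHAR('a). [:of_nat i, 1 :: 'a:])"
  define Q where "Q = Polynomial.monom (1 :: 'a) CHAR('a) - Polynomial.monom 1 1"
  define A where "A = (\<lambda>i. - of_nat i :: 'a) ` {..<CHAR('a)}"
  have p1: "CHAR('a) > 1" using p by (rule prime_gt_1_nat)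
  have inj: "inj_on (\<lambda>i. - of_nat i :: 'a) {..<CHAR('a)}"
    by (auto simp: inj_on_def of_nat_eq_iff_cong_CHAR cong_def)
  have degP: "Polynomial.degree P = CHAR('a)"
    unfolding P_def by (subst degree_prod_eq_sum_degree) auto
  have "Polynomial.lead_coeff P = 1"
    unfolding P_def by (subst lead_coeff_prod) auto
  hence "Polynomial.coeff P CHAR('a) = Polynomial.coeff Q CHAR('a)"
    using p1 by (simp add: degP Q_def)
  moreover have "Polynomial.degree Q \<le> CHAR('a)"
    unfolding Q_def using p1 by (intro degree_diff_le) (auto simp: degree_monom_eq)
  moreover have "poly P z = poly Q z" if "z \<in> A" for z
  proof -
    from that obtain i where i: "i < CHAR('a)" "z = - of_nat i" by (auto simp: A_def)
    have "poly P z = 0" using i by (auto simp: P_def poly_prod)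
    moreover have "(z + of_nat i) ^ CHAR('a) = z ^ CHAR('a) + of_nat i"
      using freshmans_dream[OF p refl] of_nat_power_CHAR[OF p] by metis
    hence "z ^ CHAR('a) + of_nat i = z + of_nat i"
      using p1 i by (simp add: zero_power)
    hence "z ^ CHAR('a) = z" by simp
    hence "poly Q z = 0" by (simp add: Q_def poly_monom)
    ultimately show ?thesis by simp
  qed
  ultimately have "P = Q"
    using degP inj by (intro poly_eqI_degree_lead_coeff[where A = A and n = "CHAR('a)"])
      (auto simp: A_def card_image)
  hence "poly P x = poly Q x" by simp
  thus ?thesis by (simp add: P_def Q_def poly_prod poly_monom add.commute)
qed

text \<open>Frobenius acts on such a root as translation by 1 and fixes the prime field.\<close>

lemma artin_schreier_root_power:
  fixes x :: "'a :: idom"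
  assumes p: "prime CHAR('a)" and x: "x ^ CHAR('a) = x + 1"
  shows "x ^ (CHAR('a) ^ n) = x + of_nat n"
proof (induction n)
  case (Suc n)
  have "x ^ (CHAR('a) ^ Suc n) = (x ^ (CHAR('a) ^ n)) ^ CHAR('a)"
    by (simp add: power_mult [symmetric] mult.commute)
  thus ?case
    by (simp add: Suc freshmans_dream[OF p refl] of_nat_power_CHAR[OF p] x)
qed auto

text \<open>The power is the product of the conjugates \<open>x + i\<close>, which equals
  \<open>x^p - x = 1\<close> with \<open>p\<close> the characteristic.\<close>

lemma artin_schreier_root_norm:
  fixes x :: "'a :: idom"
  assumes p: "prime CHAR('a)" and x: "x ^ CHAR('a) = x + 1"
  shows "x ^ (\<Sum>i<CHAR('a). CHAR('a) ^ i) = 1"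
proof -
  have "x ^ (\<Sum>i<CHAR('a). CHAR('a) ^ i) = (\<Prod>i<CHAR('a). x + of_nat i)"
    by (simp add: power_sum artin_schreier_root_power[OF assms])
  thus ?thesis by (simp add: prod_add_of_nat_CHAR[OF p] x)
qed

text \<open>The difference \<open>y - x\<close> is fixed by Frobenius, so it lies in the prime
  field, and Frobenius powers realise all such translations.\<close>

lemma artin_schreier_root_conjugate:
  fixes x y :: "'a :: idom"
  assumes p: "prime CHAR('a)" and x: "x ^ CHAR('a) = x + 1" and y: "y ^ CHAR('a) = y + 1"
  obtains i where "x = y ^ (CHAR('a) ^ i)"
proof -
  have "((y - x) + x) ^ CHAR('a) = (y - x) ^ CHAR('a) + x ^ CHAR('a)"
    by (rule freshmans_dream[OF p refl])
  hence "(y - x) ^ CHAR('a) - (y - x) = 0"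
    using x y by (simp add: algebra_simps)
  hence "(\<Prod>i<CHAR('a). (y - x) + of_nat i) = 0"
    by (simp add: prod_add_of_nat_CHAR[OF p])
  then obtain i where "(y - x) + of_nat i = 0" by auto
  hence "x = y ^ (CHAR('a) ^ i)"
    by (simp add: artin_schreier_root_power[OF p y] algebra_simps)
  thus thesis by (rule that)
qed

text \<open>Raising to the power \<open>q\<close>, prime to \<open>l\<close>, removes the factor by
  which \<open>\<theta> ^ l ^ m\<close> and \<open>\<beta>\<close> differ. If \<open>l ^ t\<close>
  is the exact power of \<open>l\<close> in \<open>N\<close>, then \<open>l ^ (t - m)\<close> times
  a number prime to \<open>l\<close> kills \<open>\<beta>\<close>, which forces
  \<open>s + m \<le> t\<close>.\<close>

lemma prime_power_dvd_exponent_of_root: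
  fixes \<theta> \<beta> :: "'a :: comm_monoid_mult" and l :: nat
  assumes l: "prime l" "\<not> l dvd q" and N: "N > 0" "\<theta> ^ N = 1"
    and root: "(\<theta> ^ l ^ m) ^ q = \<beta> ^ q"
    and ord: "\<And>n. \<beta> ^ n = 1 \<Longrightarrow> l ^ s dvd n" and s: "s > 0"
  shows "l ^ (s + m) dvd N"
proof -
  define t where "t = multiplicity l N"
  obtain N' where N': "N = l ^ t * N'" "\<not> l dvd N'"
    unfolding t_def by (rule multiplicity_decompose'[of N l]) (use N l in auto)
  \<comment> \<open>Subtraction truncates, so the case \<open>t < m\<close> is covered by a
    divisibility instead of an equality.\<close>
  have "l ^ t dvd l ^ (m + (t - m))"
    by (intro le_imp_power_dvd) simp
  then obtain c where c: "l ^ m * l ^ (t - m) = l ^ t * c"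
    by (auto simp: power_add elim: dvdE)
  have "\<beta> ^ (q * (l ^ (t - m) * N')) = (\<theta> ^ l ^ m) ^ (q * (l ^ (t - m) * N'))"
    by (simp only: power_mult root)
  also have "\<dots> = \<theta> ^ ((l ^ m * l ^ (t - m)) * (q * N'))"
    by (simp add: power_mult [symmetric] mult_ac)
  also have "\<dots> = \<theta> ^ (N * (c * q))"
    unfolding c N'(1) by (simp add: mult_ac)
  also have "\<dots> = 1" by (simp add: power_mult N)
  finally have "l ^ s dvd q * (l ^ (t - m) * N')" by (rule ord)
  moreover have "Rings.coprime (l ^ s) q" "Rings.coprime (l ^ s) N'"
    using l N'(2) by (simp_all add: prime_imp_coprime)
  ultimately have "l ^ s dvd l ^ (t - m)"
    by (simp add: coprime_dvd_mult_right_iff coprime_dvd_mult_left_iff)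
  hence "s \<le> t - m"
    using prime_gt_1_nat[OF l(1)] by (simp add: dvd_power_iff_le)
  \<comment> \<open>As \<open>s\<close> is positive, \<open>t - m\<close> is not truncated.\<close>
  hence "s + m \<le> t" using s by simp
  thus ?thesis unfolding N'(1) by (intro dvd_mult2 le_imp_power_dvd)
qed

section \<open>Polynomials over the prime field and their roots in the closure\<close>

lemma poly_map_poly_to_ac_mult:
  "poly (map_poly to_ac (f * g)) x = poly (map_poly to_ac f) x * poly (map_poly to_ac g) x"
proof -
  interpret to_ac: map_poly_comm_ring_hom "to_ac :: 'a :: field \<Rightarrow> _"
    by unfold_locales auto
  show ?thesis by (simp add: to_ac.hom_mult)
qed

text \<open>An irreducible \<open>g\<close> of degree \<open>d\<close> divides
  \<open>X^(p^d) - X\<close>.\<close>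

lemma irreducible_root_power_card:
  fixes g :: "'p :: prime_card mod_ring poly"
  assumes g: "Factorial_Ring.irreducible g" and x: "poly (map_poly to_ac g) x = 0"
  shows "x ^ (CARD('p) ^ Polynomial.degree g) = x"
proof -
  let ?h = "Polynomial.monom 1 1 ^ (CARD('p) ^ Polynomial.degree g) - Polynomial.monom 1 1
    :: 'p mod_ring poly"
  have "map_poly to_ac ?h =
      Polynomial.monom 1 (CARD('p) ^ Polynomial.degree g) - Polynomial.monom 1 1"
    by (rule poly_eqI) (auto simp: coeff_map_poly monom_power)
  moreover have "g dvd ?h" using degree_divisor1[OF g refl] .
  hence "poly (map_poly to_ac ?h) x = 0"
    using x by (metis dvdE mult_zero_left poly_map_poly_to_ac_mult)
  ultimately show ?thesis by (simp add: poly_monom)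
qed

lemma artin_schreier_pcompose_monom:
  assumes "l > 0"
  shows "artin_schreier (a :: 'p :: prime_card mod_ring) \<circ>\<^sub>p Polynomial.monom 1 l =
           Polynomial.monom 1 (CARD('p) * l) - Polynomial.monom 1 l + [:a:]"
proof -
  have "Polynomial.monom 1 n \<circ>\<^sub>p Polynomial.monom 1 l =
          (Polynomial.monom 1 (n * l) :: 'p mod_ring poly)" for n
    by (induction n) (simp_all add: monom_Suc pcompose_pCons mult_monom pcompose_1)
  thus ?thesis by (simp add: artin_schreier_def pcompose_add pcompose_diff)
qed

lemma
  fixes a :: "'p :: prime_card mod_ring"
  assumes "l > 0"
  shows degree_artin_schreier_pcompose_monom:
      "Polynomial.degree (artin_schreier a \<circ>\<^sub>p Polynomial.monom 1 l) = CARD('p) * l"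
    and lead_coeff_artin_schreier_pcompose_monom:
      "Polynomial.lead_coeff (artin_schreier a \<circ>\<^sub>p Polynomial.monom 1 l) = 1"
proof -
  let ?f = "artin_schreier a \<circ>\<^sub>p Polynomial.monom 1 l"
  have p: "CARD('p) > 1" using prime_gt_1_nat[OF prime_card[where 'a = 'p]] .
  have c: "Polynomial.coeff ?f (CARD('p) * l) = 1"
    using p assms by (auto simp: artin_schreier_pcompose_monom coeff_pCons split: nat.splits)
  have "Polynomial.degree ?f \<le> CARD('p) * l"
    using p assms unfolding artin_schreier_pcompose_monom[OF assms]
    by (intro degree_add_le degree_diff_le) (auto simp: degree_monom_eq)
  moreover have "CARD('p) * l \<le> Polynomial.degree ?f"
    using c by (intro le_degree) simp
  ultimately show d: "Polynomial.degree ?f = CARD('p) * l" by simp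
  show "Polynomial.lead_coeff ?f = 1" using c by (simp only: d)
qed

lemma nat_pow_Fpp_units: "x [^]\<^bsub>Fpp_units\<^esub> (n :: nat) = x ^ n"
  by (induction n) (auto simp: Fpp_units_def nat_pow_def)

lemma power_eq_one_iff_ord_Fpp_units_dvd:
  assumes "x \<in> carrier Fpp_units"
  shows "x ^ n = 1 \<longleftrightarrow> group.ord Fpp_units x dvd n"
proof -
  have "x [^]\<^bsub>Fpp_units\<^esub> n = \<one>\<^bsub>Fpp_units\<^esub> \<longleftrightarrow> group.ord Fpp_units x dvd n"
    by (rule group.pow_eq_id[OF group_Fpp_units assms])
  thus ?thesis by (simp add: nat_pow_Fpp_units) (simp add: Fpp_units_def)
qed

lemma poly_artin_schreier_to_ac:
  fixes a :: "'p :: prime_card mod_ring"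
  assumes "l > 0"
  shows "poly (map_poly to_ac (artin_schreier a \<circ>\<^sub>p Polynomial.monom 1 l)) x =
           (x ^ l) ^ CARD('p) - x ^ l + to_ac a"
proof -
  have "map_poly to_ac (artin_schreier a \<circ>\<^sub>p Polynomial.monom 1 l) =
          Polynomial.monom 1 (CARD('p) * l) - Polynomial.monom 1 l + [:to_ac a:]"
    using assms by (intro poly_eqI)
      (auto simp: artin_schreier_pcompose_monom coeff_map_poly coeff_pCons split: nat.splits)
  thus ?thesis by (simp add: poly_monom power_mult [symmetric] mult.commute)
qed

lemma int_power_dvd_iff:
  fixes l p n k :: nat
  assumes "p > 0"
  shows "int l ^ k dvd int p ^ n - 1 \<longleftrightarrow> l ^ k dvd p ^ n - 1"
proof -
  have "int p ^ n - 1 = int (p ^ n - 1)"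
    using assms by (simp add: of_nat_diff)
  thus ?thesis by (metis int_dvd_int_iff of_nat_power)
qed

text \<open>An irreducible factor \<open>g\<close> is shown to have full degree. The hypotheses make
  \<open>l ^ s\<close> a divisor of the order of \<open>\<alpha>\<close> and also the exact power of
  \<open>l\<close> in \<open>p ^ p - 1\<close>.\<close>

lemma irreducible_artin_schreier_pcompose_monom:
  fixes a :: "'p :: prime_card mod_ring" and \<alpha> :: "'p mod_ring alg_closure"
  defines "p \<equiv> CARD('p)"
  assumes p: "odd p" and a: "a \<noteq> 0" and \<alpha>: "\<alpha> ^ p = \<alpha> + 1"
    and l: "prime l" "odd l" "\<not> l dvd p - 1" and s: "s > 0"
    and ord: "\<And>n. \<alpha> ^ n = 1 \<Longrightarrow> l ^ s dvd n"
    and dvd: "l dvd p ^ p - 1" "\<not> l ^ Suc s dvd p ^ p - 1"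
  shows "Factorial_Ring.irreducible (artin_schreier a \<circ>\<^sub>p Polynomial.monom 1 (l ^ m))"
proof -
  let ?f = "artin_schreier a \<circ>\<^sub>p Polynomial.monom 1 (l ^ m)"
  have prime_p: "prime p" unfolding p_def by (rule prime_card)
  have char: "CHAR('p mod_ring alg_closure) = p" by (simp add: p_def)
  note p0 = prime_gt_0_nat[OF prime_p] and l0 = prime_gt_0_nat[OF l(1)]
  have deg: "Polynomial.degree ?f = p * l ^ m"
    using l0 degree_artin_schreier_pcompose_monom[of "l ^ m" a] by (simp add: p_def)
  obtain g r where g: "Factorial_Ring.irreducible g" and f: "?f = g * r"
    using irreducible\<^sub>d_factor[of ?f] unfolding deg using p0 l0 by auto
  define d where "d = Polynomial.degree g"
  have "d > 0"
    using g unfolding d_def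
    by (metis field_poly_irreducible_imp_prime gr0I irreducible_def is_unit_iff_degree)
  moreover have "Polynomial.degree (map_poly to_ac g) = d"
    unfolding d_def by (rule degree_map_poly) simp
  ultimately obtain \<theta> where \<theta>: "poly (map_poly to_ac g) \<theta> = 0"
    using alg_closed_imp_poly_has_root[of "map_poly to_ac g"] by auto
  define b where "b = to_ac a"
  \<comment> \<open>Division by \<open>- b\<close> turns \<open>\<theta> ^ l ^ m\<close> into a root
    of \<open>X^p - X - 1\<close>, because \<open>b ^ p = b\<close> and \<open>p\<close> is
    odd.\<close>
  define \<beta> where "\<beta> = - (\<theta> ^ l ^ m) / b"
  have b: "b \<noteq> 0" "b ^ p = b"
    using a fermat_theorem_mod_ring[of a] by (simp_all add: b_def p_def flip: to_ac_power)
  have "poly (map_poly to_ac ?f) \<theta> = 0"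
    unfolding f poly_map_poly_to_ac_mult \<theta> by simp
  hence root: "(\<theta> ^ l ^ m) ^ p = \<theta> ^ l ^ m - b"
    using l0 by (simp add: poly_artin_schreier_to_ac b_def p_def algebra_simps)
  have "\<beta> ^ p = \<beta> + 1"
    using p b by (simp add: \<beta>_def power_divide power_minus_odd root diff_divide_distrib)
  then obtain i where i: "\<alpha> = \<beta> ^ (p ^ i)"
    using artin_schreier_root_conjugate[of \<alpha> \<beta>] \<alpha> prime_p unfolding char by metis
  have "b ^ (p - 1) = 1"
    using b p0 by (metis mult_cancel_left2 power_minus_mult mult.commute)
  \<comment> \<open>The sign disappears as well, since \<open>p - 1\<close> is even.\<close>
  hence \<beta>_root: "(\<theta> ^ l ^ m) ^ (p - 1) = \<beta> ^ (p - 1)"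
    using p by (simp add: \<beta>_def power_divide)
  have ord_\<beta>: "l ^ s dvd n" if "\<beta> ^ n = 1" for n
  proof (rule ord)
    have "\<alpha> ^ n = (\<beta> ^ n) ^ (p ^ i)"
      unfolding i by (simp add: power_mult [symmetric] mult.commute)
    thus "\<alpha> ^ n = 1" using that by simp
  qed
  have "\<theta> \<noteq> 0"
    using root p0 l0 b by (auto simp: zero_power)
  moreover have "\<theta> ^ (p ^ d) = \<theta>"
    unfolding p_def d_def by (rule irreducible_root_power_card[OF g \<theta>])
  moreover have "p ^ d = Suc (p ^ d - 1)" using p0 by simp
  ultimately have "\<theta> ^ (p ^ d - 1) = 1"
    by (metis mult_cancel_left2 power_Suc)
  moreover have "p ^ d - 1 > 0"
    using \<open>d > 0\<close> one_less_power[of p d] prime_gt_1_nat[OF prime_p] by simp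
  ultimately have dvd_d: "l ^ (s + m) dvd p ^ d - 1"
    using prime_power_dvd_exponent_of_root[OF l(1,3) _ _ \<beta>_root ord_\<beta> s] by blast
  have cong_iff: "[p ^ n = 1] (mod l) \<longleftrightarrow> l dvd p ^ n - 1" for n
    using p0 by (simp add: cong_altdef_nat)
  have "l dvd l ^ (s + m)" using s by simp
  with dvd_d have "[p ^ d = 1] (mod l)"
    unfolding cong_iff by (rule dvd_trans[rotated])
  moreover have "[p ^ p = 1] (mod l)" "\<not> [p = 1] (mod l)"
    using dvd(1) l(3) cong_iff[of p] cong_iff[of 1] by simp_all
  ultimately have "p dvd d"
    using prime_power_order_cong_iff[OF prime_p] by blast
  then obtain k where k: "d = p * k" by (elim dvdE)
  \<comment> \<open>Lifting the exponent with base \<open>p ^ p\<close>, as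
    \<open>p ^ d = (p ^ p) ^ k\<close>.\<close>
  have "l ^ m dvd k"
  proof (rule prime_power_dvd_exponent[OF l(1,2)])
    show "[int p ^ p = 1] (mod int l)"
      using dvd(1) int_power_dvd_iff[OF p0, of l 1 p] by (simp add: cong_iff_dvd_diff)
    show "\<not> int l ^ Suc s dvd int p ^ p - 1"
      using dvd(2) int_power_dvd_iff[OF p0] by blast
    show "int l ^ (s + m) dvd (int p ^ p) ^ k - 1"
      using dvd_d int_power_dvd_iff[OF p0, of l "s + m" d] by (simp add: k power_mult)
  qed
  hence "p * l ^ m dvd d" unfolding k by (rule mult_dvd_mono[OF dvd_refl])
  hence "p * l ^ m \<le> d" using \<open>d > 0\<close> by (rule dvd_imp_le)
  \<comment> \<open>Degree comparison leaves only a nonzero constant as the cofactor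
    \<open>r\<close>.\<close>
  moreover have "?f \<noteq> 0" using deg p0 l0 by (metis degree_0 mult_pos_pos not_less0 zero_less_power)
  hence "g \<noteq> 0" "r \<noteq> 0" using f by auto
  hence "p * l ^ m = d + Polynomial.degree r"
    using deg by (simp add: f d_def degree_mult_eq)
  ultimately have "Polynomial.degree r = 0" by simp
  then obtain c where c: "r = [:c:]" by (elim degree_eq_zeroE)
  with \<open>r \<noteq> 0\<close> show ?thesis
    using g irreducible_smult_field[of c g] by (simp add: f)
qed

section \<open>The two cases for \<open>(p ^ p - 1) div e\<close>\<close>

theorem theorem4:
  fixes p e l :: nat
    and \<alpha> :: "'p :: prime_card mod_ring alg_closure"
    and T :: "nat \<Rightarrow> 'p mod_ring poly list"
  assumes p: "p = CARD('p)" "prime p" "odd p"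
    and root: "poly (map_poly to_ac (artin_schreier (-1))) \<alpha> = 0"
    and e: "e = group.ord Fpp_units \<alpha>"
    and l: "prime l" "odd l" "l dvd e"
    and T: "\<And>m. T m = map (\<lambda>a. artin_schreier (of_nat a) \<circ>\<^sub>p Polynomial.monom 1 (l ^ m)) [1..<p]"
  shows "(\<not> l dvd (p ^ p - 1) div e \<longrightarrow>
            (\<forall>m. \<forall>a \<in> {1..p - 1}.
               irreducible (artin_schreier (of_nat a :: 'p mod_ring) \<circ>\<^sub>p Polynomial.monom 1 (l ^ m))) \<and>
            (\<forall>m. twin_prime_tuple (T m) \<and>
               (\<forall>g \<in> set (T m). Polynomial.degree g = p * l ^ m \<and> odd (Polynomial.degree g))) \<and>
            infinite (range T)) \<and>
         (l dvd (p ^ p - 1) div e \<longrightarrow>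
            wieferich_prime p l)"
proof -
  have char: "CHAR('p mod_ring alg_closure) = p" by (simp add: p)
  have p1: "p > 1" and l1: "l > 1"
    using p(2) l(1) by (blast intro: prime_gt_1_nat)+
  \<comment> \<open>Viewing \<open>X\<close> as the monomial of degree 1 makes the root formula for
    compositions applicable.\<close>
  have "artin_schreier (-1) \<circ>\<^sub>p Polynomial.monom 1 1 = (artin_schreier (-1) :: 'p mod_ring poly)"
    by (simp add: artin_schreier_pcompose_monom) (simp add: artin_schreier_def)
  hence \<alpha>: "\<alpha> ^ p = \<alpha> + 1"
    using root poly_artin_schreier_to_ac[of 1 "-1 :: 'p mod_ring" \<alpha>]
    by (simp add: p algebra_simps)
  have unit: "\<alpha> \<in> carrier Fpp_units" using root by (rule root_in_Fpp_units)
  note ord = power_eq_one_iff_ord_Fpp_units_dvd[OF unit, folded e]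
  have "\<alpha> ^ (p ^ p) = \<alpha>" "\<alpha> \<noteq> 0" using unit by (auto simp: Fpp_units_def p)
  moreover have "p ^ p = Suc (p ^ p - 1)" using p1 by simp
  ultimately have "\<alpha> ^ (p ^ p - 1) = 1" by (metis mult_cancel_left2 power_Suc)
  hence "e dvd p ^ p - 1" by (simp add: ord)
  then obtain q where q: "p ^ p - 1 = e * q" by (elim dvdE)
  have "p ^ p - 1 > 0" using p1 one_less_power[of p p] by simp
  hence e0: "e > 0" unfolding q by simp
  hence q_eq: "(p ^ p - 1) div e = q" unfolding q by simp
  have "l dvd p ^ p - 1" unfolding q using l(3) by simp
  have "e dvd (\<Sum>i<p. p ^ i)"
    using artin_schreier_root_norm[of \<alpha>, unfolded char ord, OF p(2) \<alpha>] .
  hence l_norm: "l dvd (\<Sum>i<p. p ^ i)" using l(3) by (rule dvd_trans[rotated])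
  have cong_iff: "[p ^ n = 1] (mod k) \<longleftrightarrow> k dvd p ^ n - 1" for n k
    using p1 by (simp add: cong_altdef_nat)
  \<comment> \<open>If \<open>p\<close> were 1 modulo \<open>l\<close>, the norm exponent would be
    congruent to \<open>p\<close>, hence to 1, yet \<open>l\<close> divides it.\<close>
  have not_dvd: "\<not> l dvd p - 1"
  proof
    assume "l dvd p - 1"
    hence *: "[p = 1] (mod l)" using cong_iff[of 1 l] by simp
    hence "[(\<Sum>i<p. p ^ i) = (\<Sum>i<p. 1)] (mod l)"
      by (intro cong_sum) (metis cong_pow power_one)
    with l_norm have "l dvd p" by (simp add: cong_dvd_iff)
    with * have "l dvd 1" by (metis cong_dvd_iff)
    thus False using l1 by simp
  qed

  have deg: "Polynomial.degree (artin_schreier a \<circ>\<^sub>p Polynomial.monom 1 (l ^ m)) = p * l ^ m"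
    and monic: "Polynomial.lead_coeff (artin_schreier a \<circ>\<^sub>p Polynomial.monom 1 (l ^ m)) = 1"
    for a :: "'p mod_ring" and m
    using l1 degree_artin_schreier_pcompose_monom[of "l ^ m" a]
      lead_coeff_artin_schreier_pcompose_monom[of "l ^ m" a] by (simp_all add: p)

  have part1: "(\<forall>m. \<forall>a \<in> {1..p - 1}.
        irreducible (artin_schreier (of_nat a :: 'p mod_ring) \<circ>\<^sub>p Polynomial.monom 1 (l ^ m))) \<and>
      (\<forall>m. twin_prime_tuple (T m) \<and>
        (\<forall>g \<in> set (T m). Polynomial.degree g = p * l ^ m \<and> odd (Polynomial.degree g))) \<and>
      infinite (range T)"
    if nd: "\<not> l dvd q"
  proof -
    define s where "s = multiplicity l e"
    have s: "s > 0" "l ^ s dvd e" "\<not> l ^ Suc s dvd e"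
      using e0 l l1 power_dvd_iff_le_multiplicity[of e l "Suc s"] unfolding s_def
      by (simp_all add: multiplicity_gt_zero_iff multiplicity_dvd)
    \<comment> \<open>Since \<open>q\<close> is prime to \<open>l\<close>, the power of
      \<open>l\<close> in \<open>e * q = p ^ p - 1\<close> is that in \<open>e\<close>.\<close>
    have "Rings.coprime (l ^ Suc s) q" using nd l(1) by (simp add: prime_imp_coprime)
    hence "\<not> l ^ Suc s dvd p ^ p - 1"
      using s(3) coprime_dvd_mult_left_iff unfolding q by blast
    moreover have "\<alpha> ^ n = 1 \<Longrightarrow> l ^ s dvd n" for n
      using s(2) unfolding ord by (rule dvd_trans)
    ultimately have irr_nz: "irreducible (artin_schreier a \<circ>\<^sub>p Polynomial.monom 1 (l ^ m))"
      if "a \<noteq> 0" for a :: "'p mod_ring" and m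
      using irreducible_artin_schreier_pcompose_monom[of a \<alpha> l s m] that
        \<open>l dvd p ^ p - 1\<close> not_dvd l(1,2) p(3) \<alpha> s(1) unfolding p(1) by blast
    have of_nat_eq: "of_nat a = (of_nat b :: 'p mod_ring) \<longleftrightarrow> a = b" if "a < p" "b < p" for a b
      using that by (simp add: of_nat_eq_iff_cong_CHAR cong_def p)
    have irr: "irreducible (artin_schreier (of_nat a :: 'p mod_ring) \<circ>\<^sub>p Polynomial.monom 1 (l ^ m))"
      if "a \<in> {1..<p}" for a m
      using irr_nz[of "of_nat a" m] of_nat_eq[of a 0] that by auto
    have prime: "prime_poly (artin_schreier (of_nat a :: 'p mod_ring) \<circ>\<^sub>p Polynomial.monom 1 (l ^ m))"
      if "a \<in> {1..<p}" for a m
      using irr[OF that] monic by (simp add: prime_poly_def)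
    have size: "poly_size (artin_schreier a \<circ>\<^sub>p Polynomial.monom 1 (l ^ m) -
        artin_schreier b \<circ>\<^sub>p Polynomial.monom 1 (l ^ m)) = 1"
      if "a \<noteq> b" for a b :: "'p mod_ring" and m
      using that l1 by (simp add: artin_schreier_pcompose_monom poly_size_def)
    have twin: "twin_prime_tuple (T m)" for m
      unfolding twin_prime_tuple_def
    proof (intro conjI ballI allI impI)
      show "prime_poly g" if "g \<in> set (T m)" for g
        using that prime by (auto simp: T)
      fix i j assume ij: "i < length (T m)" "j < length (T m)" "i \<noteq> j"
      \<comment> \<open>The parameters start at 1, so list index \<open>k\<close> carries the
        parameter \<open>Suc k\<close>.\<close>
      have nth: "T m ! k = artin_schreier (of_nat (Suc k)) \<circ>\<^sub>p Polynomial.monom 1 (l ^ m)"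
        if "k < length (T m)" for k
        using that by (simp add: T del: of_nat_Suc)
      show "twin_prime_pair (T m ! i) (T m ! j)"
        unfolding twin_prime_pair_def nth[OF ij(1)] nth[OF ij(2)]
        using ij of_nat_eq[of "Suc i" "Suc j"]
        by (intro conjI prime size) (auto simp: T)
    qed
    have deg_T: "Polynomial.degree g = p * l ^ m" if "g \<in> set (T m)" for g m
      using that deg by (auto simp: T)
    have T_ne: "hd (T m) \<in> set (T m)" for m
      using p1 by (intro hd_in_set) (simp add: T)
    \<comment> \<open>The common degree \<open>p * l ^ m\<close> of the entries determines
      \<open>m\<close>.\<close>
    have "inj T"
    proof (rule injI)
      fix m n assume "T m = T n"
      hence "p * l ^ m = p * l ^ n"
        using deg_T T_ne by metis
      thus "m = n" using p1 l1 by (simp add: power_inject_exp)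
    qed
    hence "infinite (range T)" by (simp add: finite_image_iff)
    thus ?thesis using irr twin deg_T p(3) l(2) by auto
  qed

  have part2: "wieferich_prime p l" if "l dvd q"
  proof -
    have "\<not> l dvd p"
    proof
      assume "l dvd p"
      hence "l dvd p ^ p" using p1 dvd_trans[OF _ dvd_power[of p p]] by simp
      with \<open>l dvd p ^ p - 1\<close> have "l dvd 1"
        using dvd_diffD1[of l "p ^ p" 1] p1 by simp
      thus False using l1 by simp
    qed
    hence "Rings.coprime p l" using l(1)
      by (metis prime_imp_coprime algebraic_semidom_class.coprime_commute)
    moreover have "[p ^ (l - 1) = 1] (mod l)"
      using fermat_theorem[OF l(1) \<open>\<not> l dvd p\<close>] .
    moreover have "[p ^ p = 1] (mod l)" "\<not> [p = 1] (mod l)"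
      using \<open>l dvd p ^ p - 1\<close> not_dvd cong_iff[of p l] cong_iff[of 1 l] by simp_all
    ultimately have "p dvd l - 1"
      using prime_power_order_cong_iff[OF p(2)] by blast
    then obtain k where k: "l - 1 = p * k" by (elim dvdE)
    \<comment> \<open>One factor \<open>l\<close> comes from \<open>e\<close>, the other from
      \<open>q\<close>.\<close>
    have "l ^ 2 dvd p ^ p - 1"
      unfolding q power2_eq_square using l(3) that by (rule mult_dvd_mono)
    hence "[p ^ p = 1] (mod l ^ 2)" by (simp only: cong_iff)
    hence "[(p ^ p) ^ k = 1 ^ k] (mod l ^ 2)" by (rule cong_pow)
    hence "[p ^ (l - 1) = 1] (mod l ^ 2)" unfolding k power_mult by simp
    with \<open>Rings.coprime p l\<close> show ?thesis using l(1) by (simp add: wieferich_prime_def)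
  qed
  show ?thesis unfolding q_eq using part1 part2 by blast
qed

end
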